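(* Let $\mathbb{K}=\mathbb{R}$ or $\mathbb{C}$, let $d,n_1,\dots,n_d\geq 1$ be positive integers and let $p_1,\dots,p_d\in[1,\infty]$. Put $\gamma:=\min\{2,\max\{p_k: p_k\leq 2\}\}$ (with $\gamma:=2$ if no $p_k$ satisfies $p_k\leq 2$) and $C_d:=8\,(d!)^{1-\max\left\{\frac12,\frac{1}{\max\{p_1,\dots,p_d\}}\right\}}\sqrt{\log(1+4d)}$. Then there exist signs $\varepsilon_{\mathbf{j}}=\pm1$, $\mathbf{j}=(j_1,\dots,j_d)$ with $1\le j_k\le n_k$, and a $d$-linear map $A:\ell_{p_1}^{n_1}\times\cdots\times\ell_{p_d}^{n_d}\to\mathbb{K}$ of the form $$A(z^1,\dots,z^d)=\sum_{j_1=1}^{n_1}\cdots\sum_{j_d=1}^{n_d}\varepsilon_{\mathbf{j}}\,z^1_{j_1}\cdots z^d_{j_d}$$ such that $$\|A\|\leq (C_d)^{2\left(1-\frac1\gamma\right)}\cdot\left(\sum_{k=1}^{d}n_k\right)^{1-\frac1\gamma}\cdot\prod_{k=1}^{d}n_k^{\max\left\{\frac1\gamma-\frac1{p_k},0\right\}}.$$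
   Context: $\ell_p^n$ denotes $\mathbb{K}^n$ with the $\ell_p$-norm, $p\in[1,\infty]$, and $1/\infty:=0$. The norm is $\|A\|=\sup\{|A(z^1,\dots,z^d)|: \|z^k\|_{\ell_{p_k}^{n_k}}\leq 1,\ k=1,\dots,d\}$. *)

theory Defs
  imports "HOL-Analysis.Analysis"
begin

text \<open>A vector of \<open>K\<^sup>n\<close> is a function on \<open>nat\<close> vanishing outside \<open>{1..n}\<close>, so that the
  vector space operations are the pointwise ones.\<close>

definition coord_space :: "nat \<Rightarrow> (nat \<Rightarrow> 'a::real_normed_field) set" where
  "coord_space n = {x. \<forall>i. i \<notin> {1..n} \<longrightarrow> x i = 0}"

text \<open>The reciprocal of an exponent in \<open>[1, \<infinity>]\<close>; in particular \<open>1 / \<infinity> = 0\<close>.\<close>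

definition recip :: "ereal \<Rightarrow> real" where
  "recip p = real_of_ereal (1 / p)"

definition lp_norm :: "nat \<Rightarrow> ereal \<Rightarrow> (nat \<Rightarrow> 'a::real_normed_field) \<Rightarrow> real" where
  "lp_norm n p x =
     (if p = \<infinity> then Max ((\<lambda>i. norm (x i)) ` {1..n})
      else (\<Sum>i=1..n. norm (x i) powr real_of_ereal p) powr (1 / real_of_ereal p))"

definition tuples :: "nat \<Rightarrow> (nat \<Rightarrow> nat) \<Rightarrow> (nat \<Rightarrow> nat \<Rightarrow> 'a::real_normed_field) set" where
  "tuples d n = (\<Pi>\<^sub>E k\<in>{1..d}. coord_space (n k))"

definition multilinear_form ::
  "nat \<Rightarrow> (nat \<Rightarrow> nat) \<Rightarrow> ((nat \<Rightarrow> nat \<Rightarrow> 'a::real_normed_field) \<Rightarrow> 'a) \<Rightarrow> bool" where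
  "multilinear_form d n A \<longleftrightarrow>
     (\<forall>z\<in>tuples d n. \<forall>k\<in>{1..d}. \<forall>x\<in>coord_space (n k). \<forall>y\<in>coord_space (n k). \<forall>a b.
        A (z(k := \<lambda>i. a * x i + b * y i)) = a * A (z(k := x)) + b * A (z(k := y)))"

text \<open>The supremum is taken in the extended reals, so it is the true supremum whether or not
  the set of values is bounded.\<close>

definition form_norm ::
  "nat \<Rightarrow> (nat \<Rightarrow> nat) \<Rightarrow> (nat \<Rightarrow> ereal) \<Rightarrow> ((nat \<Rightarrow> nat \<Rightarrow> 'a::real_normed_field) \<Rightarrow> 'a) \<Rightarrow> ereal"
where
  "form_norm d n p A =
     (SUP z\<in>{z \<in> tuples d n. \<forall>k\<in>{1..d}. lp_norm (n k) (p k) (z k) \<le> 1}. ereal (norm (A z)))"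

definition multi_indices :: "nat \<Rightarrow> (nat \<Rightarrow> nat) \<Rightarrow> (nat \<Rightarrow> nat) set" where
  "multi_indices d n = (\<Pi>\<^sub>E k\<in>{1..d}. {1..n k})"

definition gamma_exp :: "nat \<Rightarrow> (nat \<Rightarrow> ereal) \<Rightarrow> ereal" where
  "gamma_exp d p =
     (if \<exists>k\<in>{1..d}. p k \<le> 2 then min 2 (Max {p k |k. k \<in> {1..d} \<and> p k \<le> 2}) else 2)"

definition C_const :: "nat \<Rightarrow> (nat \<Rightarrow> ereal) \<Rightarrow> real" where
  "C_const d p =
     8 * fact d powr (1 - max (1/2) (recip (Max (p ` {1..d})))) * sqrt (ln (1 + 4 * real d))"

definition norm_bound :: "nat \<Rightarrow> (nat \<Rightarrow> nat) \<Rightarrow> (nat \<Rightarrow> ereal) \<Rightarrow> real" where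
  "norm_bound d n p =
     C_const d p powr (2 * (1 - recip (gamma_exp d p)))
     * (\<Sum>k=1..d. real (n k)) powr (1 - recip (gamma_exp d p))
     * (\<Prod>k=1..d. real (n k) powr max (recip (gamma_exp d p) - recip (p k)) 0)"

end

theory Submission
  imports Defs "HOL-Probability.Hoeffding" "HOL-Complex_Analysis.Conformal_Mappings"
begin

text \<open>
  Everything happens over the complex numbers: restricting a complex form with real signs to real
  vectors does not increase its norm, so one choice of signs serves both fields.

  Write \<open>\<gamma>\<close> for the exponent of the theorem and \<open>S\<close> for the sum of the \<open>n\<^sub>k\<close>. Since
  \<open>1 \<le> \<gamma> \<le> 2\<close>, it suffices to bound the form when all factors carry the \<open>\<ell>\<^sub>\<gamma>\<close> norm: passing from
  \<open>\<ell>\<^sub>p\<close> to \<open>\<ell>\<^sub>\<gamma>\<close> costs nothing if \<open>p \<le> \<gamma>\<close> and the factor \<open>n\<close> to the power \<open>1/\<gamma> - 1/p\<close> otherwise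
  (\<open>sum_powr_le_of_lp_norm_le_1\<close>), which is where the product in the bound comes from.

  Any form with unimodular coefficients is bounded by \<open>1\<close> on \<open>\<ell>\<^sub>1\<close> balls. On Euclidean balls, some
  choice of signs achieves the bound \<open>B = 8 sqrt (S ln (1 + 4d))\<close> (\<open>exists_signs_l2_bound\<close>). Complex
  interpolation between these two endpoints (\<open>multilinear_interpolation\<close>) bounds the same form on
  \<open>\<ell>\<^sub>\<gamma>\<close> balls by \<open>B\<close> to the power \<open>2 (1 - 1/\<gamma>)\<close>. The power of \<open>d!\<close> in the constant is at least \<open>1\<close>,
  so this is the asserted bound.

  The Euclidean bound is a union bound over a net. By multilinearity, the norm of the form is at
  most twice the maximum of its real part over points of a net of mesh \<open>1/(2d)\<close>
  (\<open>coeff_form_perturb\<close>). For random signs each of these real parts is subgaussian with variance at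
  most \<open>1\<close>, so some signs make all of them at most \<open>sqrt (2 ln |W|)\<close>, where \<open>W\<close> is the net
  (\<open>exists_signs_all_small\<close>). A net made of lattice points has at most \<open>(1 + 4d)\<close> to the power
  \<open>4S\<close> elements (\<open>exists_net_in_l2_balls\<close>), which gives \<open>sqrt (32 S ln (1 + 4d)) \<le> B\<close>.
\<close>

section \<open>Random signs\<close>

text \<open>This is the moment generating function of a random sign. On the nonnegative half-line it is the
  case of equal weights of the auxiliary inequality behind Hoeffding's lemma, and both sides are
  even.\<close>

lemma cosh_le_exp_half_square:
  fixes x :: real
  shows "(exp x + exp (- x)) / 2 \<le> exp (x\<^sup>2 / 2)"
proof -
  have *: "(exp y + exp (- y)) / 2 \<le> exp (y\<^sup>2 / 2)" if "y \<ge> 0" for y :: real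
  proof -
    have "- (2 * y) * (1/2) + ln (1 + 1/2 * (exp (2 * y) - 1)) \<le> (2 * y)\<^sup>2 / 8"
      by (rule Hoeffdings_lemma_aux) (use that in auto)
    hence "ln ((1 + exp (2 * y)) / 2) \<le> y + y\<^sup>2 / 2"
      by (simp add: field_simps power2_eq_square)
    hence "exp (ln ((1 + exp (2 * y)) / 2)) \<le> exp (y + y\<^sup>2 / 2)"
      by (simp only: exp_le_cancel_iff)
    moreover have "(1 + exp (2 * y)) / 2 > 0" by (simp add: add_pos_pos)
    ultimately have "(1 + exp (2 * y)) / 2 \<le> exp (y + y\<^sup>2 / 2)" by (simp only: exp_ln)
    hence "exp (- y) * ((1 + exp (2 * y)) / 2) \<le> exp (- y) * exp (y + y\<^sup>2 / 2)"
      by (intro mult_left_mono) auto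
    thus ?thesis
      by (simp add: exp_add[symmetric] algebra_simps mult_exp_exp)
  qed
  from *[of x] *[of "- x"] show ?thesis by (cases "x \<ge> 0") (auto simp: add.commute)
qed

text \<open>The exponential moment method with a finite average in place of a probability measure: the mean
  over all sign patterns of \<open>\<Sum>w\<in>W. exp (l X\<^sub>w)\<close>, where \<open>X\<^sub>w\<close> is the signed sum of the row \<open>w\<close>,
  factorizes over \<open>J\<close> and is at most \<open>|W| exp (l\<^sup>2/2)\<close>. Some pattern does no worse than the mean,
  and then every single summand obeys the same bound.\<close>

lemma exists_signs_all_small:
  fixes a :: "'w \<Rightarrow> 'j \<Rightarrow> real"
  assumes "finite J" "finite W"
    and sq: "\<And>w. w \<in> W \<Longrightarrow> (\<Sum>j\<in>J. (a w j)\<^sup>2) \<le> 1"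
    and V: "V > 0" "real (card W) \<le> exp V"
  obtains e :: "'j \<Rightarrow> real" where "\<forall>j\<in>J. e j = 1 \<or> e j = -1"
    and "\<forall>w\<in>W. (\<Sum>j\<in>J. e j * a w j) \<le> sqrt (2 * V)"
proof -
  \<comment> \<open>This \<open>l\<close> minimizes the resulting bound \<open>V/l + l/2\<close> on each signed sum.\<close>
  define l where "l = sqrt (2 * V)"
  have l: "l > 0" "l\<^sup>2 = 2 * V" using V by (auto simp: l_def)
  define E where "E = PiE J (\<lambda>_. {1, -1 :: real})"
  have finE: "finite E" unfolding E_def by (intro finite_PiE) (use assms in auto)
  define f where "f = (\<lambda>e. \<Sum>w\<in>W. exp (l * (\<Sum>j\<in>J. e j * a w j)))"
  have cardE: "real (card E) = 2 ^ card J"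
    unfolding E_def by (subst card_PiE) (use assms in \<open>auto simp: numeral_2_eq_2\<close>)
  have one: "(\<Sum>e\<in>E. exp (l * (\<Sum>j\<in>J. e j * a w j))) \<le> 2 ^ card J * exp V" if w: "w \<in> W" for w
  proof -
    have "(\<Sum>e\<in>E. exp (l * (\<Sum>j\<in>J. e j * a w j))) = (\<Sum>e\<in>E. \<Prod>j\<in>J. exp (l * (e j * a w j)))"
      by (simp add: sum_distrib_left exp_sum assms)
    also have "\<dots> = (\<Prod>j\<in>J. \<Sum>s\<in>{1, -1}. exp (l * (s * a w j)))"
      unfolding E_def by (rule prod_sum_PiE[symmetric]) (use assms in auto)
    also have "\<dots> \<le> (\<Prod>j\<in>J. 2 * exp ((l * a w j)\<^sup>2 / 2))"
    proof (intro prod_mono conjI)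
      fix j assume "j \<in> J"
      show "(\<Sum>s\<in>{1, -1}. exp (l * (s * a w j))) \<le> 2 * exp ((l * a w j)\<^sup>2 / 2)"
        using cosh_le_exp_half_square[of "l * a w j"] by simp
    qed (auto intro: sum_nonneg)
    also have "\<dots> = 2 ^ card J * exp (\<Sum>j\<in>J. (l * a w j)\<^sup>2 / 2)"
      by (simp add: prod.distrib exp_sum assms)
    also have "(\<Sum>j\<in>J. (l * a w j)\<^sup>2 / 2) = V * (\<Sum>j\<in>J. (a w j)\<^sup>2)"
      by (simp add: power_mult_distrib l sum_distrib_left)
    also have "\<dots> \<le> V" using sq[OF w] V by (simp add: mult_left_le)
    finally show ?thesis by simp
  qed
  have "(\<Sum>e\<in>E. f e) = (\<Sum>w\<in>W. \<Sum>e\<in>E. exp (l * (\<Sum>j\<in>J. e j * a w j)))"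
    unfolding f_def by (rule sum.swap)
  also have "\<dots> \<le> (\<Sum>w\<in>W. 2 ^ card J * exp V)" by (intro sum_mono one)
  also have "\<dots> = 2 ^ card J * (real (card W) * exp V)" by simp
  also have "\<dots> \<le> 2 ^ card J * (exp V * exp V)" using V by (intro mult_left_mono mult_right_mono) auto
  also have "\<dots> = (\<Sum>e\<in>E. exp (2 * V))" by (simp add: cardE mult_exp_exp)
  finally have total: "(\<Sum>e\<in>E. f e) \<le> (\<Sum>e\<in>E. exp (2 * V))" .
  have "\<exists>e\<in>E. f e \<le> exp (2 * V)"
  proof (rule ccontr)
    assume "\<not> ?thesis"
    moreover have "E \<noteq> {}" by (auto simp: E_def PiE_eq_empty_iff)
    ultimately have "(\<Sum>e\<in>E. exp (2 * V)) < (\<Sum>e\<in>E. f e)"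
      using finE by (intro sum_strict_mono) auto
    with total show False by simp
  qed
  then obtain e where e: "e \<in> E" "f e \<le> exp (2 * V)" by blast
  have "(\<Sum>j\<in>J. e j * a w j) \<le> l" if "w \<in> W" for w
  proof -
    have "exp (l * (\<Sum>j\<in>J. e j * a w j)) \<le> f e"
      unfolding f_def by (rule member_le_sum) (use that assms in auto)
    also note e(2)
    finally have "l * (\<Sum>j\<in>J. e j * a w j) \<le> l * l"
      using l by (simp add: power2_eq_square)
    thus ?thesis using l by simp
  qed
  moreover have "e j = 1 \<or> e j = -1" if "j \<in> J" for j using e that by (auto simp: E_def)
  ultimately show ?thesis using that by (fold l_def) blast
qed

section \<open>Lattice points in balls\<close>

lemma sum_geometric_abs_le:
  fixes a K :: nat
  shows "(\<Sum>m\<in>{- int K..int K}. (real a / (real a + 1)) ^ nat \<bar>m\<bar>) \<le> 1 + 2 * real a"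
proof -
  define x where "x = real a / (real a + 1)"
  \<comment> \<open>The remainder term makes the induction go through; the two-sided series sums to \<open>(1+x)/(1-x)\<close>.\<close>
  have "(\<Sum>m\<in>{- int K..int K}. x ^ nat \<bar>m\<bar>) = 1 + 2 * real a - 2 * real a * x ^ K"
  proof (induction K)
    case (Suc K)
    have *: "{- int (Suc K)..int (Suc K)} = insert (- int (Suc K)) (insert (int (Suc K)) {- int K..int K})"
      by auto
    have x: "(1 + real a) * x = real a" by (simp add: x_def field_simps)
    have "(\<Sum>m\<in>{- int (Suc K)..int (Suc K)}. x ^ nat \<bar>m\<bar>)
        = 2 * x ^ Suc K + (\<Sum>m\<in>{- int K..int K}. x ^ nat \<bar>m\<bar>)"
      unfolding * by (subst sum.insert, simp, simp)+ (simp add: nat_add_distrib del: power_Suc)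
    also have "\<dots> = 1 + 2 * real a + 2 * x ^ K * (x - real a)"
      by (simp add: Suc algebra_simps)
    also have "x - real a = - real a * x" using x by (simp add: algebra_simps)
    finally show ?case by (simp add: algebra_simps)
  qed (simp add: x_def)
  moreover have "x \<ge> 0" by (simp add: x_def)
  ultimately show ?thesis by (simp add: x_def)
qed

text \<open>Markov's inequality for counting measure: each point of the \<open>\<ell>\<^sub>1\<close> ball of radius \<open>K\<close> is counted with
  weight at least \<open>1\<close> by \<open>x\<close> to the power \<open>|m| - K\<close>, and this weight factorizes over the coordinates.
  The ratio \<open>x = a / (a + 1)\<close> balances the two factors when \<open>K\<close> is about \<open>a |J|\<close>.\<close>

lemma card_l1_lattice_ball_le:
  fixes J :: "'j set" and a K :: nat
  assumes J: "finite J" and a: "a > 0"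
  shows "real (card {m \<in> PiE J (\<lambda>_. {- int K..int K}). (\<Sum>j\<in>J. \<bar>m j\<bar>) \<le> int K})
    \<le> (1 + 1 / real a) ^ K * (1 + 2 * real a) ^ card J" (is "real (card ?M) \<le> _")
proof -
  define x where "x = real a / (real a + 1)"
  have x: "0 < x" "x \<le> 1" "x * (1 + 1 / real a) = 1"
    using a by (auto simp: x_def divide_simps)
  have fin: "finite (PiE J (\<lambda>_. {- int K..int K}))" by (intro finite_PiE J) auto
  have "x ^ K * real (card ?M) = (\<Sum>m\<in>?M. x ^ K)" by simp
  also have "\<dots> \<le> (\<Sum>m\<in>?M. x ^ (\<Sum>j\<in>J. nat \<bar>m j\<bar>))"
  proof (intro sum_mono power_decreasing)
    fix m assume "m \<in> ?M"
    hence "int (\<Sum>j\<in>J. nat \<bar>m j\<bar>) \<le> int K" by simp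
    thus "(\<Sum>j\<in>J. nat \<bar>m j\<bar>) \<le> K" by linarith
  qed (use x in auto)
  also have "\<dots> \<le> (\<Sum>m\<in>PiE J (\<lambda>_. {- int K..int K}). x ^ (\<Sum>j\<in>J. nat \<bar>m j\<bar>))"
    using x fin by (intro sum_mono2) auto
  also have "\<dots> = (\<Sum>m\<in>PiE J (\<lambda>_. {- int K..int K}). \<Prod>j\<in>J. x ^ nat \<bar>m j\<bar>)"
    by (simp add: power_sum)
  also have "\<dots> = (\<Prod>j\<in>J. \<Sum>m\<in>{- int K..int K}. x ^ nat \<bar>m\<bar>)"
    by (rule prod_sum_PiE[symmetric]) (use J in auto)
  also have "\<dots> \<le> (\<Prod>j\<in>J. 1 + 2 * real a)"
    using x sum_geometric_abs_le[of a K] by (intro prod_mono) (auto simp: x_def intro!: sum_nonneg)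
  finally have "x ^ K * real (card ?M) \<le> (1 + 2 * real a) ^ card J" by simp
  hence "(1 + 1 / real a) ^ K * (x ^ K * real (card ?M)) \<le> (1 + 1 / real a) ^ K * (1 + 2 * real a) ^ card J"
    by (intro mult_left_mono) auto
  moreover have "(1 + 1 / real a) ^ K * x ^ K = 1"
    using x(3) by (simp flip: power_mult_distrib add: mult.commute)
  ultimately show ?thesis by (simp flip: mult.assoc)
qed

text \<open>Rounding towards zero, rather than to the nearest multiple, keeps rounded vectors inside the unit
  ball.\<close>

lemma round_toward_zero:
  fixes x h :: real
  assumes "h > 0"
  shows "\<exists>m::int. \<bar>x - h * m\<bar> \<le> h \<and> \<bar>h * m\<bar> \<le> \<bar>x\<bar>"
proof -
  have *: "\<exists>m::int. \<bar>y - h * m\<bar> \<le> h \<and> \<bar>h * m\<bar> \<le> \<bar>y\<bar>" if "y \<ge> 0" for y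
  proof -
    have 1: "of_int \<lfloor>y / h\<rfloor> \<le> y / h" "y / h < of_int \<lfloor>y / h\<rfloor> + 1" by linarith+
    have 2: "0 \<le> \<lfloor>y / h\<rfloor>" using that assms by simp
    have "h * \<lfloor>y / h\<rfloor> \<le> h * (y / h)" "h * (y / h) < h * (\<lfloor>y / h\<rfloor> + 1)"
      using 1 assms by (intro mult_left_mono mult_strict_left_mono; simp)+
    hence "h * \<lfloor>y / h\<rfloor> \<le> y" "y < h * \<lfloor>y / h\<rfloor> + h" using assms by (simp_all add: algebra_simps)
    with 2 that assms show ?thesis by (intro exI[of _ "\<lfloor>y / h\<rfloor>"]) auto
  qed
  show ?thesis
  proof (cases "x \<ge> 0")
    case False
    with *[of "- x"] obtain m :: int where "\<bar>- x - h * m\<bar> \<le> h \<and> \<bar>h * m\<bar> \<le> \<bar>- x\<bar>" by auto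
    thus ?thesis by (intro exI[of _ "- m"]) auto
  qed (use * in auto)
qed

text \<open>The spacing \<open>h\<close> is chosen so that an error \<open>h\<close> in each of the \<open>2 |I|\<close> real coordinates amounts to a
  Euclidean error of \<open>1/N\<close>. The third bound is the Cauchy--Schwarz inequality; an \<open>\<ell>\<^sub>1\<close> bound on the
  integer coordinates is preferable to the Euclidean one because it adds up over several blocks and
  bounds a set that is easy to count.\<close>

lemma lattice_approximation_in_l2_ball:
  fixes z :: "'i \<Rightarrow> complex" and N :: nat
  assumes I: "finite I" "I \<noteq> {}" and N: "N > 0" and z: "(\<Sum>i\<in>I. (norm (z i))\<^sup>2) \<le> 1"
  defines "h \<equiv> 1 / (real N * sqrt (2 * real (card I)))"
  shows "\<exists>m :: 'i \<times> bool \<Rightarrow> int.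
      (\<Sum>i\<in>I. (norm (of_real h * Complex (m (i, True)) (m (i, False))))\<^sup>2) \<le> 1
    \<and> (\<Sum>i\<in>I. (norm (z i - of_real h * Complex (m (i, True)) (m (i, False))))\<^sup>2) \<le> 1 / (real N)\<^sup>2
    \<and> (\<Sum>j\<in>I \<times> UNIV. \<bar>m j\<bar> :: int) \<le> int (N * (2 * card I))"
proof -
  have c: "card I > 0" using I by (simp add: card_gt_0_iff)
  have h: "h > 0" using N c by (simp add: h_def)
  have h2: "h\<^sup>2 * (real N)\<^sup>2 * (2 * real (card I)) = 1"
    using N c by (simp add: h_def power_divide power_mult_distrib)
  define x where "x = (\<lambda>(i, b). if b then Re (z i) else Im (z i))"
  have "\<forall>j. \<exists>m::int. \<bar>x j - h * m\<bar> \<le> h \<and> \<bar>h * m\<bar> \<le> \<bar>x j\<bar>"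
    using round_toward_zero[OF h] by blast
  then obtain m :: "'i \<times> bool \<Rightarrow> int" where m: "\<And>j. \<bar>x j - h * m j\<bar> \<le> h" "\<And>j. \<bar>h * m j\<bar> \<le> \<bar>x j\<bar>"
    by metis
  define w where "w = (\<lambda>i. of_real h * Complex (m (i, True)) (m (i, False)))"
  have w: "Re (w i) = h * m (i, True)" "Im (w i) = h * m (i, False)" for i by (auto simp: w_def)
  have wn: "(norm (w i))\<^sup>2 = (h * m (i, True))\<^sup>2 + (h * m (i, False))\<^sup>2" for i
    by (simp add: cmod_power2 w)
  have "(norm (w i))\<^sup>2 \<le> (norm (z i))\<^sup>2" for i
  proof -
    have "(h * m (i, True))\<^sup>2 \<le> (Re (z i))\<^sup>2" "(h * m (i, False))\<^sup>2 \<le> (Im (z i))\<^sup>2"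
      using m(2)[of "(i, True)"] m(2)[of "(i, False)"] by (auto simp: x_def abs_le_square_iff)
    thus ?thesis unfolding wn cmod_power2[of "z i"] by (rule add_mono)
  qed
  hence "(\<Sum>i\<in>I. (norm (w i))\<^sup>2) \<le> (\<Sum>i\<in>I. (norm (z i))\<^sup>2)" by (intro sum_mono)
  with z have 1: "(\<Sum>i\<in>I. (norm (w i))\<^sup>2) \<le> 1" by simp
  have "(norm (z i - w i))\<^sup>2 \<le> 2 * h\<^sup>2" for i
  proof -
    have "(Re (z i) - h * m (i, True))\<^sup>2 \<le> h\<^sup>2" "(Im (z i) - h * m (i, False))\<^sup>2 \<le> h\<^sup>2"
      using m(1)[of "(i, True)"] m(1)[of "(i, False)"] h by (auto simp: x_def simp flip: abs_le_square_iff)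
    thus ?thesis by (simp add: cmod_power2 w)
  qed
  hence "(\<Sum>i\<in>I. (norm (z i - w i))\<^sup>2) \<le> (\<Sum>i\<in>I. 2 * h\<^sup>2)" by (intro sum_mono)
  also have "\<dots> = 1 / (real N)\<^sup>2" using h2 N by (simp add: field_simps)
  finally have 2: "(\<Sum>i\<in>I. (norm (z i - w i))\<^sup>2) \<le> 1 / (real N)\<^sup>2" .
  define T where "T = (\<Sum>j\<in>I \<times> (UNIV :: bool set). real_of_int \<bar>m j\<bar>)"
  have "T\<^sup>2 \<le> (\<Sum>j\<in>I \<times> (UNIV :: bool set). (real_of_int \<bar>m j\<bar>)\<^sup>2) * real (card (I \<times> (UNIV :: bool set)))"
    unfolding T_def by (rule sum_squared_le_sum_of_squares)
  hence "h\<^sup>2 * T\<^sup>2 \<le> h\<^sup>2 * ((\<Sum>j\<in>I \<times> (UNIV :: bool set). (real_of_int (m j))\<^sup>2) * (2 * real (card I)))"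
    by (intro mult_left_mono) (auto simp: card_cartesian_product mult.commute)
  also have "\<dots> = (\<Sum>j\<in>I \<times> (UNIV :: bool set). (h * m j)\<^sup>2) * (2 * real (card I))"
    by (simp add: sum_distrib_left power_mult_distrib mult.assoc)
  also have "(\<Sum>j\<in>I \<times> (UNIV :: bool set). (h * m j)\<^sup>2) = (\<Sum>i\<in>I. (norm (w i))\<^sup>2)"
    using sum.cartesian_product[of "\<lambda>i b. (h * m (i, b))\<^sup>2" "UNIV :: bool set" I]
    by (simp add: UNIV_bool wn add.commute split_def)
  also have "\<dots> * (2 * real (card I)) \<le> 1 * (2 * real (card I))" using 1 by (intro mult_right_mono) auto
  also have "\<dots> = (2 * real (card I)) * (h\<^sup>2 * (real N)\<^sup>2 * (2 * real (card I)))" by (simp add: h2)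
  finally have "h\<^sup>2 * T\<^sup>2 \<le> h\<^sup>2 * (real N * (2 * real (card I)))\<^sup>2"
    by (simp add: power2_eq_square algebra_simps)
  hence "T \<le> real N * (2 * real (card I))"
    using h by (simp add: power2_le_iff_abs_le)
  also have "T = of_int (\<Sum>j\<in>I \<times> UNIV. \<bar>m j\<bar>)" by (simp add: T_def)
  also have "real N * (2 * real (card I)) = of_int (int (N * (2 * card I)))" by simp
  finally have 3: "(\<Sum>j\<in>I \<times> UNIV. \<bar>m j\<bar>) \<le> int (N * (2 * card I))" by (subst (asm) of_int_le_iff)
  from 1 2 3 show ?thesis unfolding w_def by (intro exI[of _ m] conjI)
qed

section \<open>Multilinear forms given by coefficients\<close>

definition coeff_form ::
  "nat \<Rightarrow> (nat \<Rightarrow> nat) \<Rightarrow> ((nat \<Rightarrow> nat) \<Rightarrow> 'a::real_normed_field) \<Rightarrow> (nat \<Rightarrow> nat \<Rightarrow> 'a) \<Rightarrow> 'a" where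
  "coeff_form d n e z = (\<Sum>j\<in>multi_indices d n. e j * (\<Prod>k=1..d. z k (j k)))"

definition in_l2_balls :: "nat \<Rightarrow> (nat \<Rightarrow> nat) \<Rightarrow> (nat \<Rightarrow> nat \<Rightarrow> 'a::real_normed_field) \<Rightarrow> bool" where
  "in_l2_balls d n z \<longleftrightarrow> (\<forall>k\<in>{1..d}. (\<Sum>i=1..n k. (norm (z k i))\<^sup>2) \<le> 1)"

lemma finite_multi_indices [simp]: "finite (multi_indices d n)"
  unfolding multi_indices_def by (intro finite_PiE) auto

lemma multi_indices_mem: "j \<in> multi_indices d n \<Longrightarrow> k \<in> {1..d} \<Longrightarrow> j k \<in> {1..n k}"
  by (auto simp: multi_indices_def PiE_iff)

text \<open>Applied to the moduli of the coordinates and to their squares, this turns norms of the factors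
  into bounds for the form.\<close>

lemma sum_prod_multi_indices:
  fixes f :: "nat \<Rightarrow> nat \<Rightarrow> 'a::comm_semiring_1"
  shows "(\<Sum>j\<in>multi_indices d n. \<Prod>k=1..d. f k (j k)) = (\<Prod>k=1..d. \<Sum>i=1..n k. f k i)"
  unfolding multi_indices_def by (rule prod_sum_PiE[symmetric]) auto

lemma coeff_form_cong:
  assumes "\<And>k i. k \<in> {1..d} \<Longrightarrow> i \<in> {1..n k} \<Longrightarrow> z k i = w k i"
  shows "coeff_form d n e z = coeff_form d n e w"
  unfolding coeff_form_def
  by (intro sum.cong prod.cong arg_cong2[where f = "(*)"] refl assms) (use multi_indices_mem in auto)

lemma coeff_form_linear:
  assumes "k \<in> {1..d}"
  shows "coeff_form d n e (z(k := \<lambda>i. a * x i + b * y i))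
       = a * coeff_form d n e (z(k := x)) + b * coeff_form d n e (z(k := y))"
proof -
  have *: "(\<Prod>l=1..d. (z(k := v)) l (j l)) = v (j k) * (\<Prod>l\<in>{1..d} - {k}. z l (j l))"
    for v and j :: "nat \<Rightarrow> nat"
  proof -
    have "(\<Prod>l=1..d. (z(k := v)) l (j l)) = v (j k) * (\<Prod>l\<in>{1..d} - {k}. (z(k := v)) l (j l))"
      using assms by (subst prod.remove[of _ k]) auto
    also have "(\<Prod>l\<in>{1..d} - {k}. (z(k := v)) l (j l)) = (\<Prod>l\<in>{1..d} - {k}. z l (j l))"
      by (intro prod.cong) auto
    finally show ?thesis .
  qed
  show ?thesis
    unfolding coeff_form_def * by (simp add: sum_distrib_left sum.distrib[symmetric] algebra_simps)
qed

lemma coeff_form_scale: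
  assumes "k \<in> {1..d}"
  shows "coeff_form d n e (z(k := \<lambda>i. a * x i)) = a * coeff_form d n e (z(k := x))"
  using coeff_form_linear[OF assms, of n e z a x 0 x] by simp

lemma coeff_form_scale_all:
  "coeff_form d n e (\<lambda>k i. c k * z k i) = (\<Prod>k=1..d. c k) * coeff_form d n e z"
  by (simp add: coeff_form_def prod.distrib sum_distrib_left algebra_simps)

text \<open>The endpoint \<open>\<ell>\<^sub>1 \<times> \<dots> \<times> \<ell>\<^sub>1\<close> of the interpolation.\<close>

lemma norm_coeff_form_le:
  assumes "\<And>j. j \<in> multi_indices d n \<Longrightarrow> norm (e j) \<le> 1"
  shows "norm (coeff_form d n e z) \<le> (\<Prod>k=1..d. \<Sum>i=1..n k. norm (z k i))"
proof -
  have "norm (coeff_form d n e z) \<le> (\<Sum>j\<in>multi_indices d n. \<Prod>k=1..d. norm (z k (j k)))"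
    unfolding coeff_form_def
    by (rule sum_norm_le) (auto simp: norm_mult prod_norm intro!: mult_left_le_one_le assms)
  thus ?thesis using sum_prod_multi_indices[of "\<lambda>k i. norm (z k i)" d n] by simp
qed

lemma in_l2_balls_coord_le:
  assumes "in_l2_balls d n z" "k \<in> {1..d}" "i \<in> {1..n k}"
  shows "norm (z k i) \<le> 1"
proof -
  have "(norm (z k i))\<^sup>2 \<le> (\<Sum>i=1..n k. (norm (z k i))\<^sup>2)"
    using assms by (intro member_le_sum) auto
  also have "\<dots> \<le> 1" using assms by (auto simp: in_l2_balls_def)
  finally show ?thesis by (simp add: power2_le_iff_abs_le[of 1, simplified])
qed

text \<open>Replace the factors of \<open>z\<close> by those of \<open>w\<close> one at a time. Each replacement changes the value by the
  form at a point whose \<open>k\<close>-th factor is the difference \<open>z\<^sub>k - w\<^sub>k\<close>; stretched by \<open>N\<close> it lies in the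
  unit ball, so the change is at most \<open>M / N\<close>.\<close>

lemma coeff_form_perturb:
  fixes z w :: "nat \<Rightarrow> nat \<Rightarrow> 'a::real_normed_field"
  assumes M: "\<And>v. in_l2_balls d n v \<Longrightarrow> norm (coeff_form d n e v) \<le> M"
    and N: "N > 0" and z: "in_l2_balls d n z" and w: "in_l2_balls d n w"
    and close: "\<And>k. k \<in> {1..d} \<Longrightarrow> (\<Sum>i=1..n k. (norm (z k i - w k i))\<^sup>2) \<le> 1 / N\<^sup>2"
  shows "norm (coeff_form d n e z - coeff_form d n e w) \<le> real d * (M / N)"
proof -
  define hyb where "hyb = (\<lambda>r k. if k \<le> r then w k else z k)"
  have "norm (coeff_form d n e z - coeff_form d n e (hyb r)) \<le> real r * (M / N)" if "r \<le> d" for r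
    using that
  proof (induction r)
    case 0
    have "coeff_form d n e z = coeff_form d n e (hyb 0)"
      by (rule coeff_form_cong) (auto simp: hyb_def)
    thus ?case by simp
  next
    case (Suc r)
    define k where "k = Suc r"
    have k: "k \<in> {1..d}" using Suc by (auto simp: k_def)
    define u where "u = (\<lambda>i. of_real N * (z k i - w k i))"
    have upd: "(hyb r)(k := z k) = hyb r" "(hyb r)(k := w k) = hyb (Suc r)"
      by (auto simp: hyb_def k_def fun_eq_iff)
    have "coeff_form d n e (hyb r) - coeff_form d n e (hyb (Suc r))
        = coeff_form d n e ((hyb r)(k := \<lambda>i. 1 * z k i + (- 1) * w k i))"
      by (subst coeff_form_linear[OF k]) (simp add: upd)
    also have "(\<lambda>i. 1 * z k i + (- 1) * w k i) = (\<lambda>i. of_real (1 / N) * u i)"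
      using N by (auto simp: u_def fun_eq_iff)
    also have "coeff_form d n e ((hyb r)(k := \<dots>)) = of_real (1 / N) * coeff_form d n e ((hyb r)(k := u))"
      by (rule coeff_form_scale[OF k])
    finally have "norm (coeff_form d n e (hyb r) - coeff_form d n e (hyb (Suc r)))
        = 1 / N * norm (coeff_form d n e ((hyb r)(k := u)))"
      using N by (simp add: norm_mult norm_divide)
    also have "\<dots> \<le> 1 / N * M"
    proof (intro mult_left_mono M)
      have "(\<Sum>i=1..n k. (norm (u i))\<^sup>2) = N\<^sup>2 * (\<Sum>i=1..n k. (norm (z k i - w k i))\<^sup>2)"
        by (simp add: u_def norm_mult power_mult_distrib sum_distrib_left)
      also have "\<dots> \<le> N\<^sup>2 * (1 / N\<^sup>2)" using close[OF k] by (intro mult_left_mono) auto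
      also have "\<dots> = 1" using N by simp
      finally show "in_l2_balls d n ((hyb r)(k := u))"
        using z w by (auto simp: in_l2_balls_def hyb_def)
    qed (use N in auto)
    finally have "norm (coeff_form d n e (hyb r) - coeff_form d n e (hyb (Suc r))) \<le> M / N" by simp
    moreover have "norm (coeff_form d n e z - coeff_form d n e (hyb r)) \<le> real r * (M / N)"
      using Suc by auto
    moreover have "norm (coeff_form d n e z - coeff_form d n e (hyb (Suc r)))
        \<le> norm (coeff_form d n e z - coeff_form d n e (hyb r))
          + norm (coeff_form d n e (hyb r) - coeff_form d n e (hyb (Suc r)))"
      by (rule order_trans[OF _ norm_triangle_ineq]) simp
    ultimately show ?case by (simp add: algebra_simps)
  qed
  from this[of d] have "norm (coeff_form d n e z - coeff_form d n e (hyb d)) \<le> real d * (M / N)" by simp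
  moreover have "coeff_form d n e (hyb d) = coeff_form d n e w"
    by (rule coeff_form_cong) (auto simp: hyb_def)
  ultimately show ?thesis by simp
qed

section \<open>Signs for the Euclidean norms\<close>

text \<open>The net consists of the lattice points in the product of the balls. They are counted jointly: in all
  there are \<open>2S\<close> integer coordinates, \<open>S\<close> being the sum of the \<open>n\<^sub>k\<close>, and rounding a point of the ball
  yields coordinates of \<open>\<ell>\<^sub>1\<close> norm at most \<open>2d \<cdot> 2S\<close>, so \<open>card_l1_lattice_ball_le\<close> applies with
  \<open>a = 2d\<close>. Since \<open>(1 + 1/a)\<close> to the power \<open>a\<close> is below \<open>e \<le> 1 + 4d\<close>, each coordinate contributes a factor
  of at most \<open>(1 + 4d)\<^sup>2\<close>.\<close>

lemma exists_net_in_l2_balls: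
  fixes d :: nat and n :: "nat \<Rightarrow> nat"
  assumes d: "d \<ge> 1" and n: "\<And>k. k \<in> {1..d} \<Longrightarrow> n k \<ge> 1"
  obtains W :: "(nat \<Rightarrow> nat \<Rightarrow> complex) set" where "finite W"
    and "real (card W) \<le> (1 + 4 * real d) ^ (4 * (\<Sum>k=1..d. n k))"
    and "\<forall>w\<in>W. in_l2_balls d n w"
    and "\<forall>z. in_l2_balls d n z \<longrightarrow> (\<exists>w\<in>W. \<forall>k\<in>{1..d}.
          (\<Sum>i=1..n k. (norm (z k i - w k i))\<^sup>2) \<le> 1 / (2 * real d)\<^sup>2)"
proof -
  \<comment> \<open>A triple \<open>(k, i, b)\<close> stands for the real (\<open>b\<close> true) or imaginary part of coordinate \<open>i\<close> of factor \<open>k\<close>.\<close>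
  define N where "N = 2 * d"
  define S where "S = (\<Sum>k=1..d. n k)"
  define J where "J = Sigma {1..d} (\<lambda>k. {1..n k} \<times> (UNIV :: bool set))"
  define h where "h = (\<lambda>k. 1 / (real N * sqrt (2 * real (n k))))"
  define K where "K = N * (2 * S)"
  define pt :: "(nat \<times> nat \<times> bool \<Rightarrow> int) \<Rightarrow> nat \<Rightarrow> nat \<Rightarrow> complex" where
    "pt = (\<lambda>m k i. of_real (h k) * Complex (m (k, i, True)) (m (k, i, False)))"
  define L where "L = {m \<in> PiE J (\<lambda>_. {- int K..int K}). (\<Sum>j\<in>J. \<bar>m j\<bar>) \<le> int K}"
  define W where "W = {w \<in> pt ` L. in_l2_balls d n w}"
  have N: "N > 0" using d by (simp add: N_def)
  have finJ: "finite J" by (auto simp: J_def)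
  have cardJ: "card J = 2 * S"
    by (simp add: J_def S_def card_SigmaI card_cartesian_product sum_distrib_left mult.commute)
  have finL: "finite L" unfolding L_def using finite_PiE[OF finJ, of "\<lambda>_. {- int K..int K}"] by auto
  have "real (card W) \<le> real (card (pt ` L))"
    using finL by (auto simp: W_def intro!: card_mono)
  also have "\<dots> \<le> real (card L)" using card_image_le[OF finL, of pt] by simp
  also have "\<dots> \<le> (1 + 1 / real N) ^ K * (1 + 2 * real N) ^ card J"
    unfolding L_def by (rule card_l1_lattice_ball_le[OF finJ N])
  also have "\<dots> = ((1 + 1 / real N) ^ N * (1 + 4 * real d)) ^ (2 * S)"
  proof -
    have "1 + 2 * real N = 1 + 4 * real d" by (simp add: N_def)
    thus ?thesis by (simp only: K_def cardJ power_mult_distrib power_mult)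
  qed
  also have "\<dots> \<le> ((1 + 4 * real d) * (1 + 4 * real d)) ^ (2 * S)"
  proof (intro power_mono mult_right_mono)
    have "(1 + 1 / real N) ^ N \<le> exp 1"
      using N by (intro exp_ge_one_plus_x_over_n_power_n) auto
    also have "exp 1 \<le> (3 :: real)" by (rule exp_le)
    also have "3 \<le> 1 + 4 * real d" using d by simp
    finally show "(1 + 1 / real N) ^ N \<le> 1 + 4 * real d" .
  qed auto
  also have "\<dots> = (1 + 4 * real d) ^ (4 * S)"
    by (simp flip: power2_eq_square power_mult)
  finally have card: "real (card W) \<le> (1 + 4 * real d) ^ (4 * S)" .
  have net: "\<exists>w\<in>W. \<forall>k\<in>{1..d}. (\<Sum>i=1..n k. (norm (z k i - w k i))\<^sup>2) \<le> 1 / (2 * real d)\<^sup>2"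
    if z: "in_l2_balls d n z" for z :: "nat \<Rightarrow> nat \<Rightarrow> complex"
  proof -
    define good where "good = (\<lambda>k (m :: nat \<times> bool \<Rightarrow> int).
        (\<Sum>i=1..n k. (norm (of_real (h k) * Complex (m (i, True)) (m (i, False))))\<^sup>2) \<le> 1
      \<and> (\<Sum>i=1..n k. (norm (z k i - of_real (h k) * Complex (m (i, True)) (m (i, False))))\<^sup>2) \<le> 1 / (real N)\<^sup>2
      \<and> (\<Sum>j\<in>{1..n k} \<times> UNIV. \<bar>m j\<bar> :: int) \<le> int (N * (2 * n k)))"
    have "\<exists>m. good k m" if k: "k \<in> {1..d}" for k
    proof -
      have "{1..n k} \<noteq> {}" "(\<Sum>i=1..n k. (norm (z k i))\<^sup>2) \<le> 1"
        using n[OF k] z k by (simp_all add: in_l2_balls_def)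
      from lattice_approximation_in_l2_ball[OF finite_atLeastAtMost this(1) N this(2)]
      show ?thesis unfolding good_def h_def card_atLeastAtMost diff_Suc_1 .
    qed
    then obtain m where m: "\<And>k. k \<in> {1..d} \<Longrightarrow> good k (m k)" by metis
    define M where "M = restrict (\<lambda>(k, j). m k j) J"
    have MJ: "M (k, i, b) = m k (i, b)" if "k \<in> {1..d}" "i \<in> {1..n k}" for k i b
      using that by (simp add: M_def J_def)
    have ptM: "pt M k i = of_real (h k) * Complex (m k (i, True)) (m k (i, False))"
      if "k \<in> {1..d}" "i \<in> {1..n k}" for k i
      using that by (simp add: pt_def MJ)
    have "(\<Sum>j\<in>J. \<bar>M j\<bar>) = (\<Sum>(k, j)\<in>J. \<bar>m k j\<bar>)"
      by (intro sum.cong) (auto simp: M_def)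
    also have "\<dots> = (\<Sum>k=1..d. \<Sum>j\<in>{1..n k} \<times> UNIV. \<bar>m k j\<bar>)"
      unfolding J_def by (rule sum.Sigma[symmetric]) auto
    also have "\<dots> \<le> (\<Sum>k=1..d. int (N * (2 * n k)))"
      using m by (intro sum_mono) (simp only: good_def)
    also have "\<dots> = int K" by (simp add: K_def S_def sum_distrib_left)
    finally have sumM: "(\<Sum>j\<in>J. \<bar>M j\<bar>) \<le> int K" .
    have "\<bar>M j\<bar> \<le> int K" if "j \<in> J" for j
      using member_le_sum[of j J "\<lambda>j. \<bar>M j\<bar>"] that finJ sumM by auto
    hence "M \<in> PiE J (\<lambda>_. {- int K..int K})"
      by (force simp: M_def PiE_iff abs_le_iff)
    with sumM have "M \<in> L" by (simp add: L_def)
    moreover have "in_l2_balls d n (pt M)"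
      unfolding in_l2_balls_def
    proof
      fix k assume k: "k \<in> {1..d}"
      show "(\<Sum>i=1..n k. (norm (pt M k i))\<^sup>2) \<le> 1"
        using m[OF k] unfolding good_def by (simp only: ptM[OF k] cong: sum.cong)
    qed
    ultimately have "pt M \<in> W" by (auto simp: W_def)
    moreover have "(\<Sum>i=1..n k. (norm (z k i - pt M k i))\<^sup>2) \<le> 1 / (2 * real d)\<^sup>2" if "k \<in> {1..d}" for k
      using m[OF that] unfolding good_def by (simp add: ptM[OF that] N_def)
    ultimately show ?thesis by blast
  qed
  show ?thesis
  proof (rule that[of W])
    show "finite W" using finL by (simp add: W_def)
    show "real (card W) \<le> (1 + 4 * real d) ^ (4 * (\<Sum>k=1..d. n k))" using card by (simp only: S_def)
    show "\<forall>w\<in>W. in_l2_balls d n w" by (simp add: W_def)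
  qed (intro allI impI net)
qed

text \<open>The supremum \<open>M\<close> of the form over the balls satisfies \<open>M \<le> T + M/2\<close>, where \<open>T\<close> bounds the real parts
  of the form on the net; absorbing \<open>M/2\<close> requires \<open>M\<close> to be finite, which is clear in finite
  dimension.\<close>

lemma exists_signs_l2_bound:
  fixes d :: nat and n :: "nat \<Rightarrow> nat"
  assumes d: "d \<ge> 1" and n: "\<And>k. k \<in> {1..d} \<Longrightarrow> n k \<ge> 1"
  obtains e :: "(nat \<Rightarrow> nat) \<Rightarrow> real"
  where "\<forall>j\<in>multi_indices d n. e j = 1 \<or> e j = -1"
    and "\<forall>z :: nat \<Rightarrow> nat \<Rightarrow> complex. in_l2_balls d n z \<longrightarrow>
       norm (coeff_form d n (\<lambda>j. of_real (e j)) z)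
         \<le> 8 * sqrt (ln (1 + 4 * real d)) * sqrt (\<Sum>k=1..d. real (n k))"
proof -
  define S where "S = (\<Sum>k=1..d. n k)"
  define V where "V = 4 * real S * ln (1 + 4 * real d)"
  obtain W :: "(nat \<Rightarrow> nat \<Rightarrow> complex) set" where W: "finite W"
    "real (card W) \<le> (1 + 4 * real d) ^ (4 * (\<Sum>k=1..d. n k))"
    "\<forall>w\<in>W. in_l2_balls d n w"
    "\<forall>z. in_l2_balls d n z \<longrightarrow> (\<exists>w\<in>W. \<forall>k\<in>{1..d}.
          (\<Sum>i=1..n k. (norm (z k i - w k i))\<^sup>2) \<le> 1 / (2 * real d)\<^sup>2)"
    by (rule exists_net_in_l2_balls[of d n, OF d n])
  have "n 1 \<le> S" unfolding S_def by (rule member_le_sum) (use d in auto)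
  hence S: "S \<ge> 1" using n[of 1] d by simp
  have L: "ln (1 + 4 * real d) > 0" using d by simp
  have V: "V > 0" using S L by (simp add: V_def)
  have eqV: "exp V = exp (ln (1 + 4 * real d)) ^ (4 * S)"
    by (subst exp_of_nat_mult[symmetric]) (simp add: V_def)
  hence expV: "real (card W) \<le> exp V" using W(2) unfolding S_def by simp
  have sq: "(\<Sum>j\<in>multi_indices d n. (Re (\<Prod>k=1..d. w k (j k)))\<^sup>2) \<le> 1" if "w \<in> W" for w
  proof -
    \<comment> \<open>The variance of the real part at \<open>w\<close> is at most the product of the squared Euclidean norms.\<close>
    have "(\<Sum>j\<in>multi_indices d n. (Re (\<Prod>k=1..d. w k (j k)))\<^sup>2)
        \<le> (\<Sum>j\<in>multi_indices d n. \<Prod>k=1..d. (norm (w k (j k)))\<^sup>2)"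
    proof (rule sum_mono)
      fix j
      have "(Re (\<Prod>k=1..d. w k (j k)))\<^sup>2 \<le> (norm (\<Prod>k=1..d. w k (j k)))\<^sup>2"
        by (simp add: abs_Re_le_cmod flip: abs_le_square_iff)
      thus "(Re (\<Prod>k=1..d. w k (j k)))\<^sup>2 \<le> (\<Prod>k=1..d. (norm (w k (j k)))\<^sup>2)"
        by (simp only: prod_norm[symmetric] prod_power_distrib)
    qed
    also have "\<dots> = (\<Prod>k=1..d. \<Sum>i=1..n k. (norm (w k i))\<^sup>2)"
      by (rule sum_prod_multi_indices)
    also have "\<dots> \<le> 1"
      using W(3) that by (intro prod_le_1) (auto simp: in_l2_balls_def intro: sum_nonneg)
    finally show ?thesis .
  qed
  obtain e :: "(nat \<Rightarrow> nat) \<Rightarrow> real" where e: "\<forall>j\<in>multi_indices d n. e j = 1 \<or> e j = -1"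
    and small: "\<forall>w\<in>W.
      (\<Sum>j\<in>multi_indices d n. e j * Re (\<Prod>k=1..d. w k (j k))) \<le> sqrt (2 * V)"
    by (rule exists_signs_all_small[where a = "\<lambda>w j. Re (\<Prod>k=1..d. w k (j k))",
          OF finite_multi_indices W(1) sq V expV])
  define F :: "(nat \<Rightarrow> nat \<Rightarrow> complex) \<Rightarrow> complex" where "F = coeff_form d n (\<lambda>j. of_real (e j))"
  have ReF: "Re (F w) \<le> sqrt (2 * V)" if "w \<in> W" for w
    using small that by (simp add: F_def coeff_form_def)
  define M where "M = (SUP z\<in>{z. in_l2_balls d n z}. norm (F z))"
  have "norm (F z) \<le> (\<Prod>k=1..d. real (n k))" if "in_l2_balls d n z" for z
  proof -
    have "norm (F z) \<le> (\<Prod>k=1..d. \<Sum>i=1..n k. norm (z k i))"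
      unfolding F_def by (rule norm_coeff_form_le) (use e in force)
    also have "\<dots> \<le> (\<Prod>k=1..d. \<Sum>i=1..n k. 1)"
      using in_l2_balls_coord_le[OF that] by (intro prod_mono conjI sum_nonneg sum_mono) auto
    finally show ?thesis by simp
  qed
  hence bdd: "bdd_above ((\<lambda>z. norm (F z)) ` {z. in_l2_balls d n z})"
    by (intro bdd_aboveI2) auto
  have le_M: "norm (F z) \<le> M" if "in_l2_balls d n z" for z
    unfolding M_def using bdd that by (intro cSUP_upper) auto
  have half: "norm (F z) \<le> sqrt (2 * V) + M / 2" if z: "in_l2_balls d n z" for z
  proof -
    \<comment> \<open>Rotating the first factor makes the value of the form real and nonnegative, so that only real
      parts have to be controlled on the net.\<close>
    obtain c :: complex where c: "norm c = 1" "c * F z = of_real (norm (F z))"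
    proof (cases "F z = 0")
      case False
      show ?thesis
        by (rule that[of "cnj (F z) / of_real (norm (F z))"])
          (use False in \<open>auto simp: norm_divide divide_simps complex_norm_square[symmetric] power2_eq_square mult.commute\<close>)
    qed (auto intro: that[of 1])
    define z' where "z' = z(1 := \<lambda>i. c * z 1 i)"
    have rot: "F z' = c * F z"
      unfolding z'_def F_def by (subst coeff_form_scale) (use d in auto)
    have z': "in_l2_balls d n z'"
      using z c by (auto simp: z'_def in_l2_balls_def norm_mult)
    then obtain w where w: "w \<in> W" "\<forall>k\<in>{1..d}. (\<Sum>i=1..n k. (norm (z' k i - w k i))\<^sup>2) \<le> 1 / (2 * real d)\<^sup>2"
      using W(4) by blast
    have "norm (F z' - F w) \<le> real d * (M / (2 * real d))"
      unfolding F_def using le_M z' W(3) w d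
      by (intro coeff_form_perturb) (auto simp: F_def)
    also have "\<dots> = M / 2" using d by simp
    finally have "Re (F z' - F w) \<le> M / 2" using complex_Re_le_cmod[of "F z' - F w"] by linarith
    thus ?thesis using ReF[OF w(1)] c(2) rot by simp
  qed
  have "M \<le> sqrt (2 * V) + M / 2"
    unfolding M_def
  proof (rule cSUP_least)
    have "in_l2_balls d n (\<lambda>_ _. 0 :: complex)" by (simp add: in_l2_balls_def)
    thus "{z. in_l2_balls d n (z :: nat \<Rightarrow> nat \<Rightarrow> complex)} \<noteq> {}" by blast
  qed (use half in \<open>auto simp: M_def\<close>)
  hence "M \<le> 2 * sqrt (2 * V)" by simp
  also have "\<dots> = sqrt (2\<^sup>2 * (2 * V))" by (simp only: real_sqrt_mult real_sqrt_abs abs_numeral)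
  also have "\<dots> \<le> sqrt (8\<^sup>2 * ln (1 + 4 * real d) * real S)"
    using L S by (simp add: V_def mult_right_mono)
  also have "\<dots> = 8 * sqrt (ln (1 + 4 * real d)) * sqrt (\<Sum>k=1..d. real (n k))"
    by (simp only: real_sqrt_mult real_sqrt_abs abs_numeral S_def of_nat_sum)
  finally have M: "M \<le> 8 * sqrt (ln (1 + 4 * real d)) * sqrt (\<Sum>k=1..d. real (n k))" .
  show ?thesis
  proof (rule that[OF e])
    show "\<forall>z :: nat \<Rightarrow> nat \<Rightarrow> complex. in_l2_balls d n z \<longrightarrow>
        norm (coeff_form d n (\<lambda>j. of_real (e j)) z)
          \<le> 8 * sqrt (ln (1 + 4 * real d)) * sqrt (\<Sum>k=1..d. real (n k))"
      unfolding F_def[symmetric] using le_M M order_trans by blast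
  qed
qed

section \<open>Complex interpolation\<close>

text \<open>Hadamard's three lines theorem. Dividing by the exponential function of modulus \<open>1\<close> on the left
  edge and \<open>B\<close> on the right edge reduces it to the bound \<open>1\<close> on both edges. The Gaussian
  factor, removed in the limit \<open>\<delta> \<rightarrow> 0\<close>, makes the function small at the far ends of the strip, so the
  maximum principle on a long rectangle suffices.\<close>

lemma three_lines:
  fixes F :: "complex \<Rightarrow> complex"
  assumes hol: "F holomorphic_on UNIV"
    and K: "\<And>s. 0 \<le> Re s \<Longrightarrow> Re s \<le> 1 \<Longrightarrow> norm (F s) \<le> K"
    and left: "\<And>s. Re s = 0 \<Longrightarrow> norm (F s) \<le> 1"
    and right: "\<And>s. Re s = 1 \<Longrightarrow> norm (F s) \<le> B"
    and B: "B > 0" and t: "0 \<le> t" "t \<le> 1"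
  shows "norm (F (of_real t)) \<le> B powr t"
proof -
  define G where "G = (\<lambda>\<delta> s. F s * exp (- s * of_real (ln B)) * exp (of_real \<delta> * (s\<^sup>2 - 1)))"
  have normG: "norm (G \<delta> s) = norm (F s) * exp (- Re s * ln B) * exp (\<delta> * ((Re s)\<^sup>2 - (Im s)\<^sup>2 - 1))" for \<delta> s
    by (simp add: G_def norm_mult power2_eq_square)
  have strip: "norm (F (of_real t)) * exp (- t * ln B) * exp (\<delta> * (t\<^sup>2 - 1)) \<le> 1" if \<delta>: "\<delta> > 0" for \<delta>
  proof -
    \<comment> \<open>\<open>T\<close> is so large that the Gaussian factor outweighs \<open>Q\<close> on the horizontal edges.\<close>
    define Q where "Q = \<bar>K\<bar> * exp \<bar>ln B\<bar>"
    define T where "T = sqrt (\<bar>Q\<bar> / \<delta>) + 1"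
    have T: "T > 0" using \<delta> by (auto simp: T_def intro!: add_nonneg_pos)
    have "\<bar>Q\<bar> / \<delta> \<le> T\<^sup>2"
      using \<delta> by (simp add: T_def power2_sum)
    hence "Q \<le> \<delta> * T\<^sup>2" using \<delta> by (simp add: field_simps)
    also have "\<dots> \<le> exp (\<delta> * T\<^sup>2)" using exp_ge_add_one_self[of "\<delta> * T\<^sup>2"] by linarith
    finally have QT: "Q * exp (- (\<delta> * T\<^sup>2)) \<le> 1" by (simp add: exp_minus field_simps)
    have "norm (G \<delta> (of_real t)) \<le> 1"
    proof (rule maximum_modulus_frontier[where f = "G \<delta>" and \<xi> = "of_real t" and S = "cbox (Complex 0 (- T)) (Complex 1 T)"])
      have hG: "G \<delta> holomorphic_on UNIV" unfolding G_def by (intro holomorphic_intros hol)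
      show "G \<delta> holomorphic_on interior (cbox (Complex 0 (- T)) (Complex 1 T))"
        by (rule holomorphic_on_subset[OF hG]) simp
      show "continuous_on (closure (cbox (Complex 0 (- T)) (Complex 1 T))) (G \<delta>)"
        by (rule holomorphic_on_imp_continuous_on[OF holomorphic_on_subset[OF hG]]) simp
      show "bounded (cbox (Complex 0 (- T)) (Complex 1 T))" by (rule bounded_cbox)
      show "of_real t \<in> cbox (Complex 0 (- T)) (Complex 1 T)"
        using t T by (auto simp: in_cbox_complex_iff)
      fix s assume "s \<in> frontier (cbox (Complex 0 (- T)) (Complex 1 T))"
      hence s: "0 \<le> Re s" "Re s \<le> 1" and "Re s = 0 \<or> Re s = 1 \<or> \<bar>Im s\<bar> = T"
        by (auto simp: frontier_def in_cbox_complex_iff in_box_complex_iff)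
      have sq: "(Re s)\<^sup>2 \<le> 1" using s by (simp add: power_le_one)
      have "(Re s)\<^sup>2 - (Im s)\<^sup>2 - 1 \<le> 0" using sq zero_le_power2[of "Im s"] by linarith
      hence e1: "exp (\<delta> * ((Re s)\<^sup>2 - (Im s)\<^sup>2 - 1)) \<le> 1"
        using \<delta> by (simp add: mult_nonneg_nonpos)
      from \<open>Re s = 0 \<or> Re s = 1 \<or> \<bar>Im s\<bar> = T\<close> show "norm (G \<delta> s) \<le> 1"
      proof (elim disjE)
        assume "Re s = 0"
        thus ?thesis unfolding normG using left[of s] e1 by (intro mult_le_one) auto
      next
        assume 1: "Re s = 1"
        have "norm (F s) * exp (- Re s * ln B) \<le> B * exp (- Re s * ln B)"
          using right[OF 1] by (intro mult_right_mono) auto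
        also have "\<dots> = 1" using B 1 by (simp add: exp_minus)
        finally have "norm (F s) * exp (- Re s * ln B) \<le> 1" .
        from mult_le_one[OF this exp_ge_zero e1] show ?thesis unfolding normG .
      next
        assume Im: "\<bar>Im s\<bar> = T"
        hence Im: "(Im s)\<^sup>2 = T\<^sup>2" by (metis power2_abs)
        have "- Re s * ln B \<le> \<bar>Re s\<bar> * \<bar>ln B\<bar>" by (metis abs_ge_self abs_minus abs_mult)
        also have "\<dots> \<le> 1 * \<bar>ln B\<bar>" using s by (intro mult_right_mono) auto
        finally have "norm (F s) * exp (- Re s * ln B) \<le> \<bar>K\<bar> * exp \<bar>ln B\<bar>"
          using K[OF s] by (intro mult_mono) auto
        moreover have "exp (\<delta> * ((Re s)\<^sup>2 - (Im s)\<^sup>2 - 1)) \<le> exp (- (\<delta> * T\<^sup>2))"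
          using \<delta> sq by (simp add: Im algebra_simps mult_left_le)
        ultimately have "norm (G \<delta> s) \<le> Q * exp (- (\<delta> * T\<^sup>2))"
          unfolding normG Q_def by (rule mult_mono) auto
        with QT show ?thesis by simp
      qed
    qed
    thus ?thesis by (simp add: normG)
  qed
  have "((\<lambda>\<delta>. norm (F (of_real t)) * exp (- t * ln B) * exp (\<delta> * (t\<^sup>2 - 1)))
      \<longlongrightarrow> norm (F (of_real t)) * exp (- t * ln B) * exp (0 * (t\<^sup>2 - 1))) (at_right 0)"
    by (intro tendsto_intros)
  moreover have "\<forall>\<^sub>F \<delta> in at_right 0.
      norm (F (of_real t)) * exp (- t * ln B) * exp (\<delta> * (t\<^sup>2 - 1)) \<le> 1"
    using eventually_at_right_less[of "0 :: real"] by (rule eventually_mono) (rule strip)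
  ultimately have "norm (F (of_real t)) * exp (- t * ln B) * exp (0 * (t\<^sup>2 - 1)) \<le> 1"
    by (rule tendsto_upperbound) simp
  thus ?thesis using B by (simp add: powr_def exp_minus field_simps)
qed

text \<open>The Riesz--Thorin argument: deform \<open>z\<close> analytically by keeping the phases of its coordinates and
  replacing their moduli \<open>r\<close> by \<open>r\<close> to the power \<open>g (1 - s/2)\<close>. On the line \<open>Re s = 0\<close> the deformed factors
  lie in the \<open>\<ell>\<^sub>1\<close> ball, on \<open>Re s = 1\<close> in the \<open>\<ell>\<^sub>2\<close> ball, and \<open>z\<close> itself is recovered at the point where
  \<open>1 - s/2 = 1/g\<close>.\<close>

lemma multilinear_interpolation:
  fixes z :: "nat \<Rightarrow> nat \<Rightarrow> complex" and g B :: real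
  assumes e: "\<And>j. j \<in> multi_indices d n \<Longrightarrow> norm (e j) \<le> 1"
    and B: "B > 0" "\<And>v. in_l2_balls d n v \<Longrightarrow> norm (coeff_form d n e v) \<le> B"
    and g: "1 \<le> g" "g \<le> 2"
    and z: "\<And>k. k \<in> {1..d} \<Longrightarrow> (\<Sum>i=1..n k. norm (z k i) powr g) \<le> 1"
  shows "norm (coeff_form d n e z) \<le> B powr (2 * (1 - 1 / g))"
proof -
  define Z :: "complex \<Rightarrow> nat \<Rightarrow> nat \<Rightarrow> complex" where
    "Z = (\<lambda>s k i. if z k i = 0 then 0
      else sgn (z k i) * exp (of_real (g * ln (norm (z k i))) * (1 - s / 2)))"
  define F where "F = (\<lambda>s. coeff_form d n e (Z s))"
  have normZ: "norm (Z s k i) = norm (z k i) powr (g * (1 - Re s / 2))" for s k i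
    by (simp add: Z_def norm_mult norm_sgn powr_def algebra_simps)
  have holZ: "(\<lambda>s. Z s k i) holomorphic_on UNIV" for k i
    by (cases "z k i = 0") (auto simp: Z_def intro!: holomorphic_intros)
  have hol: "F holomorphic_on UNIV"
    unfolding F_def coeff_form_def by (intro holomorphic_intros holZ)
  have z1: "norm (z k i) \<le> 1" if "k \<in> {1..d}" "i \<in> {1..n k}" for k i
  proof (rule ccontr)
    assume "\<not> norm (z k i) \<le> 1"
    hence "1 < norm (z k i) powr g" using g by (intro gr_one_powr) auto
    also have "\<dots> \<le> (\<Sum>i=1..n k. norm (z k i) powr g)"
      using that by (intro member_le_sum) auto
    also have "\<dots> \<le> 1" by (rule z) fact
    finally show False by simp
  qed
  have F_le: "norm (F s) \<le> (\<Prod>k=1..d. \<Sum>i=1..n k. norm (Z s k i))" for s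
    unfolding F_def by (rule norm_coeff_form_le[OF e])
  have "norm (F (of_real (2 * (1 - 1 / g)))) \<le> B powr (2 * (1 - 1 / g))"
  proof (rule three_lines[OF hol])
    fix s :: complex assume s: "0 \<le> Re s" "Re s \<le> 1"
    \<comment> \<open>Any bound on the whole strip will do; this one counts the terms of the form.\<close>
    have "norm (Z s k i) \<le> 1" if "k \<in> {1..d}" "i \<in> {1..n k}" for k i
      unfolding normZ using z1[OF that] s g by (intro powr_le1) auto
    hence "(\<Prod>k=1..d. \<Sum>i=1..n k. norm (Z s k i)) \<le> (\<Prod>k=1..d. \<Sum>i=1..n k. 1)"
      by (intro prod_mono conjI sum_nonneg sum_mono) auto
    with F_le[of s] show "norm (F s) \<le> (\<Prod>k=1..d. \<Sum>i=1..n k. 1)" by (rule order_trans)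
  next
    fix s :: complex assume s: "Re s = 0"
    have "(\<Prod>k=1..d. \<Sum>i=1..n k. norm (Z s k i)) \<le> 1"
      using z by (intro prod_le_1) (auto simp: normZ s intro!: sum_nonneg)
    with F_le[of s] show "norm (F s) \<le> 1" by (rule order_trans)
  next
    fix s :: complex assume s: "Re s = 1"
    have "(norm (Z s k i))\<^sup>2 = norm (z k i) powr g" for k i
      by (simp add: normZ s power2_eq_square flip: powr_add)
    hence "in_l2_balls d n (Z s)" using z by (simp add: in_l2_balls_def)
    thus "norm (F s) \<le> B" unfolding F_def by (rule B(2))
  qed (use B g in \<open>auto simp: field_simps\<close>)
  also have "F (of_real (2 * (1 - 1 / g))) = coeff_form d n e z"
    unfolding F_def
  proof (rule coeff_form_cong)
    fix k i
    have "(of_real (g * ln (norm (z k i))) * (1 - of_real (2 * (1 - 1 / g)) / 2) :: complex)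
        = of_real (g * ln (norm (z k i)) * (1 - (2 * (1 - 1 / g)) / 2))"
      by (simp only: of_real_mult of_real_diff of_real_divide of_real_1 of_real_numeral)
    also have "g * ln (norm (z k i)) * (1 - (2 * (1 - 1 / g)) / 2) = ln (norm (z k i))"
      using g by (simp add: field_simps)
    finally show "Z (of_real (2 * (1 - 1 / g))) k i = z k i"
      by (simp add: Z_def exp_of_real sgn_eq del: of_real_mult of_real_diff of_real_divide)
  qed
  finally show ?thesis .
qed

section \<open>Exponents and changes of norm\<close>

lemma recip_ereal [simp]: "recip (ereal q) = 1 / q"
  by (cases "q = 0") (auto simp: recip_def one_ereal_def)

lemma recip_infinity [simp]: "recip \<infinity> = 0"
  by (simp add: recip_def)

lemma recip_le_1: "p \<ge> 1 \<Longrightarrow> recip p \<le> 1"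
  by (cases p) (auto simp: one_ereal_def)

text \<open>For \<open>p \<le> g\<close> the coordinates have modulus at most \<open>1\<close>, so raising the exponent decreases the sum. For
  \<open>p > g\<close> this is the power mean inequality, obtained by summing Young's inequality for
  \<open>n |x\<^sub>i|\<^sup>p\<close> and \<open>1\<close> with weights \<open>g/p\<close> and \<open>1 - g/p\<close>.\<close>

lemma sum_powr_le_of_lp_norm_le_1:
  fixes x :: "nat \<Rightarrow> 'a::real_normed_field" and p :: ereal
  assumes p: "p \<ge> 1" and x: "lp_norm n p x \<le> 1" and g: "g \<ge> 1" and n: "n \<ge> 1"
  shows "(\<Sum>i=1..n. norm (x i) powr g) \<le> (real n powr max (1 / g - recip p) 0) powr g"
proof (cases p)
  case PInf
  have "norm (x i) \<le> 1" if "i \<in> {1..n}" for i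
  proof -
    have "norm (x i) \<le> Max ((\<lambda>i. norm (x i)) ` {1..n})" using that by (intro Max_ge) auto
    with x PInf show ?thesis by (simp add: lp_norm_def)
  qed
  hence "(\<Sum>i=1..n. norm (x i) powr g) \<le> (\<Sum>i=1..n. 1)"
    using g by (intro sum_mono powr_le1) auto
  thus ?thesis using g n PInf by (simp add: powr_powr)
next
  case (real q)
  hence q: "q \<ge> 1" using p by (simp add: one_ereal_def)
  define S where "S = (\<Sum>i=1..n. norm (x i) powr q)"
  have S1: "S \<le> 1"
  proof (rule ccontr)
    assume "\<not> S \<le> 1"
    hence "1 < S powr (1 / q)" using q by (intro gr_one_powr) auto
    with x real show False by (simp add: lp_norm_def S_def)
  qed
  show ?thesis
  proof (cases "q \<le> g")
    case True
    have "norm (x i) powr g \<le> norm (x i) powr q" if i: "i \<in> {1..n}" for i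
    proof (rule powr_mono'[OF True])
      show "norm (x i) \<le> 1"
      proof (rule ccontr)
        assume "\<not> norm (x i) \<le> 1"
        hence "1 < norm (x i) powr q" using q by (intro gr_one_powr) auto
        also have "\<dots> \<le> S" unfolding S_def using i by (intro member_le_sum) auto
        finally show False using S1 by simp
      qed
    qed auto
    hence "(\<Sum>i=1..n. norm (x i) powr g) \<le> S" unfolding S_def by (rule sum_mono)
    also have "\<dots> \<le> 1" by (rule S1)
    also have "1 = (real n powr max (1 / g - recip p) 0) powr g"
      using True g q n real by (simp add: max_def field_simps)
    finally show ?thesis .
  next
    case False
    define r where "r = g / q"
    have r: "0 < r" "r < 1" using False g q by (auto simp: r_def field_simps)
    have "real n powr r * norm (x i) powr g \<le> r * (real n * norm (x i) powr q) + (1 - r)" for i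
    proof (cases "x i = 0")
      case False
      have "(real n * norm (x i) powr q) powr r * 1 powr (1 - r)
          \<le> r * (real n * norm (x i) powr q) + (1 - r) * 1"
        using r n False by (intro Youngs_inequality_0) auto
      also have "(real n * norm (x i) powr q) powr r = real n powr r * norm (x i) powr g"
        using q by (simp add: powr_mult powr_powr r_def)
      finally show ?thesis by simp
    qed (use r in auto)
    hence "(\<Sum>i=1..n. real n powr r * norm (x i) powr g)
        \<le> (\<Sum>i=1..n. r * (real n * norm (x i) powr q) + (1 - r))"
      by (rule sum_mono)
    also have "\<dots> = r * real n * S + real n * (1 - r)"
      by (simp add: sum.distrib S_def sum_distrib_left mult.assoc)
    also have "\<dots> \<le> r * real n * 1 + real n * (1 - r)"
      using S1 r by (intro add_right_mono mult_left_mono) auto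
    also have "\<dots> = real n" by (simp add: algebra_simps)
    finally have "real n powr r * (\<Sum>i=1..n. norm (x i) powr g) \<le> real n"
      by (simp add: sum_distrib_left)
    hence "(\<Sum>i=1..n. norm (x i) powr g) \<le> real n / real n powr r"
      using n by (simp add: field_simps)
    also have "\<dots> = real n powr (1 - r)" using n by (simp add: powr_diff)
    also have "1 - r = max (1 / g - recip p) 0 * g"
      using False g q real by (simp add: r_def max_def field_simps)
    finally show ?thesis by (simp add: powr_powr)
  qed
qed (use p in auto)

lemma gamma_exp_cases:
  fixes p :: "nat \<Rightarrow> ereal"
  assumes "\<And>k. k \<in> {1..d} \<Longrightarrow> p k \<ge> 1"
  obtains g where "gamma_exp d p = ereal g" "1 \<le> g" "g \<le> 2"
proof -
  have "1 \<le> gamma_exp d p \<and> gamma_exp d p \<le> 2"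
  proof (cases "\<exists>k\<in>{1..d}. p k \<le> 2")
    case True
    then obtain k where k: "k \<in> {1..d}" "p k \<le> 2" by blast
    have "finite {p k |k. k \<in> {1..d} \<and> p k \<le> 2}" by simp
    hence "p k \<le> Max {p k |k. k \<in> {1..d} \<and> p k \<le> 2}" using k by (intro Max_ge) auto
    with assms[OF k(1)] have "1 \<le> Max {p k |k. k \<in> {1..d} \<and> p k \<le> 2}" by (rule order_trans)
    moreover have "(1 :: ereal) \<le> 2" by simp
    ultimately show ?thesis using True unfolding gamma_exp_def by simp
  next
    case False
    moreover have "(1 :: ereal) \<le> 2" by simp
    ultimately show ?thesis by (auto simp: gamma_exp_def)
  qed
  thus ?thesis using that by (cases "gamma_exp d p") (auto simp: one_ereal_def)
qed

section \<open>Existence of the form\<close>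

text \<open>Rescaling the factor \<open>z\<^sub>k\<close> by \<open>R\<^sub>k\<close>, the norm of the inclusion of \<open>\<ell>\<^sub>p\<close> into \<open>\<ell>\<^sub>\<gamma>\<close>, moves it into the
  unit ball of \<open>\<ell>\<^sub>\<gamma>\<close>, where the interpolated bound applies; homogeneity returns the product of the
  \<open>R\<^sub>k\<close>.\<close>

lemma exists_signs_lp_bound:
  fixes d :: nat and n :: "nat \<Rightarrow> nat" and p :: "nat \<Rightarrow> ereal"
  assumes d: "d \<ge> 1" and n: "\<And>k. k \<in> {1..d} \<Longrightarrow> n k \<ge> 1" and p: "\<And>k. k \<in> {1..d} \<Longrightarrow> p k \<ge> 1"
  obtains e :: "(nat \<Rightarrow> nat) \<Rightarrow> real"
  where "\<forall>j\<in>multi_indices d n. e j = 1 \<or> e j = -1"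
    and "\<forall>z :: nat \<Rightarrow> nat \<Rightarrow> complex. (\<forall>k\<in>{1..d}. lp_norm (n k) (p k) (z k) \<le> 1) \<longrightarrow>
           norm (coeff_form d n (\<lambda>j. of_real (e j)) z) \<le> norm_bound d n p"
proof -
  define S where "S = (\<Sum>k=1..d. real (n k))"
  define L where "L = 8 * sqrt (ln (1 + 4 * real d))"
  obtain e :: "(nat \<Rightarrow> nat) \<Rightarrow> real" where e: "\<forall>j\<in>multi_indices d n. e j = 1 \<or> e j = -1"
    and l2: "\<forall>z :: nat \<Rightarrow> nat \<Rightarrow> complex. in_l2_balls d n z \<longrightarrow>
       norm (coeff_form d n (\<lambda>j. of_real (e j)) z)
         \<le> 8 * sqrt (ln (1 + 4 * real d)) * sqrt (\<Sum>k=1..d. real (n k))"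
    by (rule exists_signs_l2_bound[of d n, OF d n])
  obtain g where g: "gamma_exp d p = ereal g" "1 \<le> g" "g \<le> 2"
    by (rule gamma_exp_cases[of d p, OF p])
  define t where "t = 1 - 1 / g"
  have t: "t \<ge> 0" using g by (simp add: t_def)
  have L: "L > 0" using d by (simp add: L_def)
  have "real (n 1) \<le> S" unfolding S_def by (rule member_le_sum) (use d in auto)
  hence S: "S > 0" using n[of 1] d by simp
  have "L \<le> C_const d p"
  proof -
    have "Max (p ` {1..d}) \<in> p ` {1..d}" using d by (intro Max_in) auto
    hence "recip (Max (p ` {1..d})) \<le> 1" using p by (auto intro: recip_le_1)
    hence "(1 :: real) \<le> fact d powr (1 - max (1/2) (recip (Max (p ` {1..d}))))"
      by (intro ge_one_powr_ge_zero) (auto simp: fact_ge_1)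
    hence "8 * 1 * sqrt (ln (1 + 4 * real d)) \<le> C_const d p"
      unfolding C_const_def by (intro mult_right_mono mult_left_mono) (use d in auto)
    thus ?thesis by (simp add: L_def)
  qed
  hence "L powr (2 * t) \<le> C_const d p powr (2 * t)" using L t by (intro powr_mono2) auto
  hence base: "(L * sqrt S) powr (2 * t) \<le> C_const d p powr (2 * t) * S powr t"
    using S L by (simp add: powr_mult powr_powr mult_right_mono flip: powr_half_sqrt)
  define R where "R = (\<lambda>k. real (n k) powr max (1 / g - recip (p k)) 0)"
  have R: "R k > 0" if "k \<in> {1..d}" for k using n[OF that] by (simp add: R_def)
  have "norm (coeff_form d n (\<lambda>j. of_real (e j)) z) \<le> norm_bound d n p"
    if z: "\<forall>k\<in>{1..d}. lp_norm (n k) (p k) (z k) \<le> 1" for z :: "nat \<Rightarrow> nat \<Rightarrow> complex"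
  proof -
    define u :: "nat \<Rightarrow> nat \<Rightarrow> complex" where "u = (\<lambda>k i. z k i / of_real (R k))"
    have "(\<Sum>i=1..n k. norm (u k i) powr g) \<le> 1" if k: "k \<in> {1..d}" for k
    proof -
      have "(\<Sum>i=1..n k. norm (u k i) powr g) = (\<Sum>i=1..n k. norm (z k i) powr g) / R k powr g"
        using R[OF k] by (simp add: u_def norm_divide powr_divide sum_divide_distrib)
      also have "\<dots> \<le> R k powr g / R k powr g"
        unfolding R_def
        by (intro divide_right_mono sum_powr_le_of_lp_norm_le_1 p z[rule_format] n k) (use g in auto)
      finally show ?thesis using R[OF k] by simp
    qed
    hence u: "norm (coeff_form d n (\<lambda>j. of_real (e j)) u) \<le> (L * sqrt S) powr (2 * (1 - 1 / g))"
      using L S g by (intro multilinear_interpolation l2[folded L_def S_def, rule_format])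
        (use e in force)+
    have "coeff_form d n (\<lambda>j. of_real (e j)) z
        = coeff_form d n (\<lambda>j. of_real (e j)) (\<lambda>k i. of_real (R k) * u k i)"
      by (rule coeff_form_cong) (use R in \<open>force simp: u_def\<close>)
    also have "\<dots> = (\<Prod>k=1..d. of_real (R k)) * coeff_form d n (\<lambda>j. of_real (e j)) u"
      by (rule coeff_form_scale_all)
    finally have "norm (coeff_form d n (\<lambda>j. of_real (e j)) z)
        = (\<Prod>k=1..d. R k) * norm (coeff_form d n (\<lambda>j. of_real (e j)) u)"
      by (simp add: norm_mult R_def flip: prod_norm)
    also have "\<dots> \<le> (\<Prod>k=1..d. R k) * (C_const d p powr (2 * t) * S powr t)"
      using u base by (intro mult_left_mono) (auto simp: t_def R_def intro: prod_nonneg)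
    also have "\<dots> = norm_bound d n p"
      by (simp add: norm_bound_def g(1) t_def S_def R_def)
    finally show ?thesis .
  qed
  thus ?thesis by (intro that[OF e] allI impI)
qed

lemma coeff_form_of_real:
  "coeff_form d n (\<lambda>j. of_real (e j)) (\<lambda>k i. of_real (z k i))
     = (of_real (coeff_form d n e z) :: 'a::real_normed_field)"
  by (simp add: coeff_form_def)

lemma lp_norm_of_real:
  "lp_norm n p (\<lambda>i. of_real (x i) :: 'a::real_normed_field) = lp_norm n p x"
  by (simp add: lp_norm_def)

lemma coeff_form_witness:
  fixes e :: "(nat \<Rightarrow> nat) \<Rightarrow> real"
  assumes e: "\<forall>j\<in>multi_indices d n. e j = 1 \<or> e j = -1"
    and bound: "\<forall>z :: nat \<Rightarrow> nat \<Rightarrow> 'a::real_normed_field.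
      (\<forall>k\<in>{1..d}. lp_norm (n k) (p k) (z k) \<le> 1) \<longrightarrow>
      norm (coeff_form d n (\<lambda>j. of_real (e j)) z) \<le> C"
  shows "\<exists>(\<epsilon> :: (nat \<Rightarrow> nat) \<Rightarrow> 'a) A.
        (\<forall>j\<in>multi_indices d n. \<epsilon> j = 1 \<or> \<epsilon> j = -1)
      \<and> multilinear_form d n A
      \<and> (\<forall>z\<in>tuples d n. A z = (\<Sum>j\<in>multi_indices d n. \<epsilon> j * (\<Prod>k=1..d. z k (j k))))
      \<and> form_norm d n p A \<le> ereal C"
proof (intro exI conjI)
  let ?\<epsilon> = "\<lambda>j. of_real (e j) :: 'a"
  show "\<forall>j\<in>multi_indices d n. ?\<epsilon> j = 1 \<or> ?\<epsilon> j = -1" using e by force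
  show "multilinear_form d n (coeff_form d n ?\<epsilon>)"
    unfolding multilinear_form_def using coeff_form_linear by blast
  show "\<forall>z\<in>tuples d n. coeff_form d n ?\<epsilon> z = (\<Sum>j\<in>multi_indices d n. ?\<epsilon> j * (\<Prod>k=1..d. z k (j k)))"
    by (simp add: coeff_form_def)
  show "form_norm d n p (coeff_form d n ?\<epsilon>) \<le> ereal C"
    unfolding form_norm_def by (rule SUP_least) (use bound in auto)
qed

theorem theorem2p4:
  fixes d :: nat and n :: "nat \<Rightarrow> nat" and p :: "nat \<Rightarrow> ereal"
  assumes "d \<ge> 1"
    and "\<And>k. k \<in> {1..d} \<Longrightarrow> n k \<ge> 1"
    and "\<And>k. k \<in> {1..d} \<Longrightarrow> p k \<ge> 1"
  shows
    "(\<exists>(\<epsilon> :: (nat \<Rightarrow> nat) \<Rightarrow> real) A.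
        (\<forall>j\<in>multi_indices d n. \<epsilon> j = 1 \<or> \<epsilon> j = -1)
      \<and> multilinear_form d n A
      \<and> (\<forall>z\<in>tuples d n. A z = (\<Sum>j\<in>multi_indices d n. \<epsilon> j * (\<Prod>k=1..d. z k (j k))))
      \<and> form_norm d n p A \<le> ereal (norm_bound d n p))
   \<and> (\<exists>(\<epsilon> :: (nat \<Rightarrow> nat) \<Rightarrow> complex) A.
        (\<forall>j\<in>multi_indices d n. \<epsilon> j = 1 \<or> \<epsilon> j = -1)
      \<and> multilinear_form d n A
      \<and> (\<forall>z\<in>tuples d n. A z = (\<Sum>j\<in>multi_indices d n. \<epsilon> j * (\<Prod>k=1..d. z k (j k))))
      \<and> form_norm d n p A \<le> ereal (norm_bound d n p))"
proof -
  obtain e :: "(nat \<Rightarrow> nat) \<Rightarrow> real" where e: "\<forall>j\<in>multi_indices d n. e j = 1 \<or> e j = -1"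
    and complex_bound: "\<forall>z :: nat \<Rightarrow> nat \<Rightarrow> complex.
      (\<forall>k\<in>{1..d}. lp_norm (n k) (p k) (z k) \<le> 1) \<longrightarrow>
      norm (coeff_form d n (\<lambda>j. of_real (e j)) z) \<le> norm_bound d n p"
    by (rule exists_signs_lp_bound[of d n p, OF assms])
  have real_bound: "\<forall>z :: nat \<Rightarrow> nat \<Rightarrow> real. (\<forall>k\<in>{1..d}. lp_norm (n k) (p k) (z k) \<le> 1) \<longrightarrow>
      norm (coeff_form d n (\<lambda>j. of_real (e j)) z) \<le> norm_bound d n p"
  proof (intro allI impI)
    fix z :: "nat \<Rightarrow> nat \<Rightarrow> real"
    assume "\<forall>k\<in>{1..d}. lp_norm (n k) (p k) (z k) \<le> 1"
    hence "norm (coeff_form d n (\<lambda>j. of_real (e j)) (\<lambda>k i. complex_of_real (z k i))) \<le> norm_bound d n p"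
      by (intro complex_bound[rule_format]) (simp only: lp_norm_of_real)
    thus "norm (coeff_form d n (\<lambda>j. of_real (e j)) z) \<le> norm_bound d n p"
      by (simp add: coeff_form_of_real)
  qed
  show ?thesis
    using coeff_form_witness[OF e real_bound] coeff_form_witness[OF e complex_bound] by (rule conjI)
qed

end
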